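(* Let $m\ge 1$ be an integer and $k\in[0,1]$, and let $R^k_{m,2}$ be the maximal positive root of the equation $\Lambda_m(r)=0$, where $$\Lambda_m (r)=(1-r)(r^{2m}+2r^m-1)+2r(r+k)(1+r^m)^2 .$$ Suppose that $f(z)= h(z) + \overline{g(z)} =\sum_{n = 0}^\infty a_nz^n + \overline{\sum_{n = 1}^\infty b_nz^n}$ is a harmonic mapping of $\mathbb{D}$ such that $h\in\mathcal{B}$ and $|g'(z)|\leq k|h'(z)|$ for all $z\in\mathbb{D}$. Then $$|h(z^m)|+|z^m|\,|h'(z^m)|+\sum_{n=2}^\infty |a_n|r^n + \sum_{n=1}^\infty |b_n|r^n \le 1 \quad\text{for all } z\in\mathbb{D}\text{ with } |z|=r \le R^k_{m,2}.$$ Moreover, the constant $R^k_{m,2}$ cannot be improved, i.e. it cannot be replaced by any larger number: for every $R'\in(R^k_{m,2},1)$ there exist a harmonic mapping $f(z)=h(z)+\overline{g(z)}=\sum_{n=0}^\infty a_nz^n+\overline{\sum_{n=1}^\infty b_nz^n}$ of $\mathbb{D}$ with $h\in\mathcal{B}$ and $|g'(z)|\le k|h'(z)|$ for all $z\in\mathbb{D}$ (with the same $k$), and a point $z$ with $|z|=r\le R'$, for which $$|h(z^m)|+|z^m|\,|h'(z^m)|+\sum_{n=2}^\infty |a_n|r^n + \sum_{n=1}^\infty |b_n|r^n > 1.$$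
   Context: $\mathbb{D}=\{z\in\mathbb{C}: |z|<1\}$, and $\mathcal{B}$ is the set of analytic functions $h$ in $\mathbb{D}$ with $|h(z)|<1$ for all $z\in\mathbb{D}$. A harmonic mapping of $\mathbb{D}$ is here a complex-valued function $f=h+\overline{g}$ with $h(z)=\sum_{n=0}^\infty a_nz^n$ and $g(z)=\sum_{n=1}^\infty b_nz^n$ analytic in $\mathbb{D}$ (so $g(0)=0$). *)

theory Defs
  imports "HOL-Complex_Analysis.Complex_Analysis"
begin

abbreviation unit_disc :: "complex set" ("\<D>") where
  "\<D> \<equiv> ball 0 1"

definition class_B :: "(complex \<Rightarrow> complex) set" ("\<B>") where
  "\<B> = {h. h analytic_on \<D> \<and> (\<forall>z\<in>\<D>. norm (h z) < 1)}"

text \<open>The coefficients of \<open>g\<close> are indexed from \<open>1\<close>, so \<open>b 0\<close> is never used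
  and \<open>g 0 = 0\<close> holds automatically.\<close>

definition harmonic_mapping ::
  "(complex \<Rightarrow> complex) \<Rightarrow> (complex \<Rightarrow> complex) \<Rightarrow> (complex \<Rightarrow> complex) \<Rightarrow>
   (nat \<Rightarrow> complex) \<Rightarrow> (nat \<Rightarrow> complex) \<Rightarrow> bool" where
  "harmonic_mapping f h g a b \<longleftrightarrow>
     h analytic_on \<D> \<and> g analytic_on \<D> \<and>
     (\<forall>z\<in>\<D>. (\<lambda>n. a n * z ^ n) sums h z) \<and>
     (\<forall>z\<in>\<D>. (\<lambda>n. b (n + 1) * z ^ (n + 1)) sums g z) \<and>
     (\<forall>z\<in>\<D>. f z = h z + cnj (g z))"

definition Lam :: "nat \<Rightarrow> real \<Rightarrow> real \<Rightarrow> real" ("\<Lambda>") where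
  "\<Lambda> m k r = (1 - r) * (r ^ (2 * m) + 2 * r ^ m - 1) + 2 * r * (r + k) * (1 + r ^ m)\<^sup>2"

definition bohr_radius :: "nat \<Rightarrow> real \<Rightarrow> real" where
  "bohr_radius m k = (GREATEST r. 0 < r \<and> \<Lambda> m k r = 0)"

text \<open>For \<open>norm z < 1\<close> both series below converge absolutely, being evaluated
  strictly inside the disc of convergence of \<open>h\<close> and \<open>g\<close>.\<close>

definition bohr_sum ::
  "nat \<Rightarrow> (complex \<Rightarrow> complex) \<Rightarrow> (nat \<Rightarrow> complex) \<Rightarrow> (nat \<Rightarrow> complex) \<Rightarrow> complex \<Rightarrow> real" where
  "bohr_sum m h a b z =
     norm (h (z ^ m)) + norm (z ^ m) * norm (deriv h (z ^ m))
     + (\<Sum>n. norm (a (n + 2)) * norm z ^ (n + 2))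
     + (\<Sum>n. norm (b (n + 1)) * norm z ^ (n + 1))"

lemma Lam_pos:
  assumes "k \<ge> 0" "r \<ge> 1"
  shows "\<Lambda> m k r > 0"
proof -
  define t where "t = r ^ m"
  have t: "t \<ge> 1" using assms by (simp add: t_def)
  have "(r - 1) * (t\<^sup>2 + 2 * t - 1) \<le> r * (1 + t)\<^sup>2"
    using assms t mult_mono[of 1 t 1 t]
    by (intro mult_mono) (auto simp: power2_eq_square algebra_simps)
  also have "\<dots> < 2 * r * r * (1 + t)\<^sup>2"
    using assms t by (intro mult_strict_right_mono) auto
  also have "\<dots> \<le> 2 * r * (r + k) * (1 + t)\<^sup>2"
    using assms t by (intro mult_right_mono mult_left_mono) auto
  finally show ?thesis
    by (simp add: Lam_def t_def power_mult [symmetric] algebra_simps)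
qed

lemma bohr_radius_greatest_root:
  assumes "m \<ge> 1" "k \<ge> 0"
  shows "0 < bohr_radius m k" "bohr_radius m k < 1" "\<Lambda> m k (bohr_radius m k) = 0"
    and "\<And>r. 0 < r \<Longrightarrow> \<Lambda> m k r = 0 \<Longrightarrow> r \<le> bohr_radius m k"
proof -
  define A where "A = {r \<in> {0..1}. \<Lambda> m k r = 0}"
  have cont: "continuous_on S (\<Lambda> m k)" for S
    unfolding Lam_def by (intro continuous_intros)
  have zero: "\<Lambda> m k 0 < 0" using assms by (simp add: Lam_def power_0_left)
  have one: "\<Lambda> m k 1 > 0" using Lam_pos assms by simp
  have "\<exists>x\<ge>0. x \<le> 1 \<and> \<Lambda> m k x = 0"
    using IVT'[of "\<Lambda> m k" 0 0 1] zero one cont by auto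
  then have ne: "A \<noteq> {}" by (auto simp: A_def)
  have "closed A" unfolding A_def
    by (intro continuous_closed_preimage_constant cont) auto
  then have "compact A"
    by (metis (no_types, lifting) A_def Collect_subset Int_absorb1 compact_Icc
        compact_Int_closed inf.commute mem_Collect_eq subsetI)
  then obtain s where s: "s \<in> A" "\<And>t. t \<in> A \<Longrightarrow> t \<le> s"
    using compact_attains_sup ne by metis
  have s': "0 < s" "s < 1" "\<Lambda> m k s = 0"
    using s(1) zero one by (auto simp: A_def less_le)
  have max: "r \<le> s" if "0 < r" "\<Lambda> m k r = 0" for r
    using Lam_pos[of k r m] s(2)[of r] assms that by (cases "r \<ge> 1") (auto simp: A_def)
  have "bohr_radius m k = s"
    unfolding bohr_radius_def using s' max by (intro Greatest_equality) auto
  with s' max show "0 < bohr_radius m k" "bohr_radius m k < 1" "\<Lambda> m k (bohr_radius m k) = 0"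
    "\<And>r. 0 < r \<Longrightarrow> \<Lambda> m k r = 0 \<Longrightarrow> r \<le> bohr_radius m k"
    by auto
qed

end

theory Submission
  imports Defs
begin

text \<open>
  Put \<open>\<alpha> = |a 0|\<close>, \<open>r = |z|\<close>, \<open>t = r ^ m\<close>. The Schwarz--Pick lemma bounds the first two terms of the
  Bohr sum by their values for the disc automorphism \<open>(z + \<alpha>) / (1 + \<alpha> z)\<close>; this uses
  \<open>t\<^sup>2 + 2 t \<le> 1\<close>, which holds up to the Bohr radius. Parseval's identity gives \<open>|a n| \<le> 1 - \<alpha>\<^sup>2\<close>,
  and, applied to \<open>|g'| \<le> k |h'|\<close> and integrated twice in \<open>r\<^sup>2\<close>, the inequality
  \<open>\<Sum> |b n|\<^sup>2 r ^ n \<le> k\<^sup>2 \<Sum> |a n|\<^sup>2 r ^ n\<close>, from which Cauchy--Schwarz bounds \<open>\<Sum> |b n| r ^ n\<close>.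
  The resulting estimate is worst as \<open>\<alpha>\<close> tends to \<open>1\<close>, where it says \<open>\<Lambda> m k r \<le> 0\<close>. The
  automorphisms with \<open>g = k (h - \<alpha>)\<close> and \<open>\<alpha>\<close> close to \<open>1\<close> show sharpness.
\<close>

section \<open>Parseval's identity\<close>

text \<open>Orthogonality of the characters of the circle. The frequency is an integer because
  multiplying a term by the conjugate of another one subtracts their exponents.\<close>

lemma has_integral_cis_int:
  "((\<lambda>\<theta>. cis (of_int k * \<theta>)) has_integral (if k = 0 then 2 * of_real pi else 0)) {0..2 * pi}"
proof (cases "k = 0")
  case True
  with has_integral_const_real[of "1::complex" 0 "2 * pi"] show ?thesis
    by (simp add: scaleR_conv_of_real)
next
  case False
  define K where "K = (of_int k :: complex)"
  have K: "K \<noteq> 0" using False by (simp add: K_def)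
  have cis_eq: "cis (of_int k * \<theta>) = exp (\<i> * K * of_real \<theta>)" for \<theta>
    by (simp add: cis_conv_exp K_def mult.assoc)
  have "((\<lambda>\<theta>. exp (\<i> * K * of_real \<theta>)) has_integral
      (exp (\<i> * K * of_real (2 * pi)) / (\<i> * K) - exp (\<i> * K * of_real 0) / (\<i> * K))) {0..2 * pi}"
  proof (rule fundamental_theorem_of_calculus)
    fix x :: real assume "x \<in> {0..2 * pi}"
    have "((\<lambda>z. exp (\<i> * K * z) / (\<i> * K)) has_field_derivative exp (\<i> * K * of_real x))
        (at (of_real x))"
      using K by (auto intro!: derivative_eq_intros)
    then show "((\<lambda>\<theta>. exp (\<i> * K * of_real \<theta>) / (\<i> * K)) has_vector_derivative
        exp (\<i> * K * of_real x)) (at x within {0..2 * pi})"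
      by (rule has_vector_derivative_real_field)
  qed simp
  moreover have "exp (\<i> * K * of_real (2 * pi)) = 1"
    using exp_integer_2pi[of "of_int k"] by (simp add: K_def mult_ac)
  ultimately show ?thesis using False by (simp add: cis_eq)
qed

text \<open>Expanding the square gives a double sum over the frequencies \<open>i - j\<close>;
  orthogonality leaves only the diagonal. The computation runs in the complex numbers and returns to
  the reals through \<open>Re\<close>.\<close>

lemma has_integral_norm_square_fourier_sum:
  "((\<lambda>\<theta>. (norm (\<Sum>n<N. d n * cis (real n * \<theta>)))\<^sup>2) has_integral
     2 * pi * (\<Sum>n<N. (norm (d n))\<^sup>2)) {0..2 * pi}"
proof -
  have expand: "of_real ((norm (\<Sum>n<N. d n * cis (real n * \<theta>)))\<^sup>2) =
      (\<Sum>i<N. \<Sum>j<N. d i * cnj (d j) * cis (of_int (int i - int j) * \<theta>))" for \<theta>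
  proof -
    have "cis (real i * \<theta>) * cnj (cis (real j * \<theta>)) = cis (of_int (int i - int j) * \<theta>)" for i j
      by (simp add: cis_cnj cis_mult algebra_simps)
    then show ?thesis
      by (simp add: complex_norm_square sum_product cnj_sum mult_ac flip: of_real_power)
  qed
  have "((\<lambda>\<theta>. \<Sum>i<N. \<Sum>j<N. d i * cnj (d j) * cis (of_int (int i - int j) * \<theta>)) has_integral
      (\<Sum>i<N. \<Sum>j<N. d i * cnj (d j) * (if int i - int j = 0 then 2 * of_real pi else 0))) {0..2 * pi}"
    by (intro has_integral_sum has_integral_mult_right has_integral_cis_int) auto
  also have "(\<Sum>i<N. \<Sum>j<N. d i * cnj (d j) * (if int i - int j = 0 then 2 * of_real pi else 0)) =
      (\<Sum>i<N. \<Sum>j<N. if j = i then d i * cnj (d i) * (2 * of_real pi) else 0)"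
    by (intro sum.cong) auto
  also have "\<dots> = of_real (2 * pi * (\<Sum>n<N. (norm (d n))\<^sup>2))"
    by (simp add: sum.delta complex_norm_square sum_distrib_left mult_ac flip: of_real_power)
  finally have "((\<lambda>\<theta>. of_real ((norm (\<Sum>n<N. d n * cis (real n * \<theta>)))\<^sup>2) :: complex) has_integral
      of_real (2 * pi * (\<Sum>n<N. (norm (d n))\<^sup>2))) {0..2 * pi}"
    unfolding expand .
  from has_integral_linear[OF this bounded_linear_Re] show ?thesis
    by (simp add: o_def)
qed

lemma summable_norm_square:
  fixes d :: "nat \<Rightarrow> 'a::real_normed_vector"
  assumes "summable (\<lambda>n. norm (d n))"
  shows "summable (\<lambda>n. (norm (d n))\<^sup>2)"
proof (rule summable_comparison_test_ev[OF _ assms])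
  have "eventually (\<lambda>n. norm (d n) < 1) sequentially"
    using order_tendstoD(2)[OF summable_LIMSEQ_zero[OF assms]] by simp
  then show "eventually (\<lambda>n. norm ((norm (d n))\<^sup>2) \<le> norm (d n)) sequentially"
    by eventually_elim (auto simp: power2_eq_square intro: mult_left_le)
qed

text \<open>Dominated convergence carries Parseval's identity from the partial sums to the series;
  the square of the sum of all norms is a constant majorant.\<close>

lemma has_integral_norm_square_fourier:
  assumes sm: "summable (\<lambda>n. norm (d n))"
  shows "((\<lambda>\<theta>. (norm (\<Sum>n. d n * cis (real n * \<theta>)))\<^sup>2) has_integral
     2 * pi * (\<Sum>n. (norm (d n))\<^sup>2)) {0..2 * pi}"
proof -
  define P where "P N \<theta> = (norm (\<Sum>n<N. d n * cis (real n * \<theta>)))\<^sup>2" for N \<theta>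
  define f where "f \<theta> = (norm (\<Sum>n. d n * cis (real n * \<theta>)))\<^sup>2" for \<theta>
  have P: "(P N has_integral 2 * pi * (\<Sum>n<N. (norm (d n))\<^sup>2)) {0..2 * pi}" for N
    unfolding P_def by (rule has_integral_norm_square_fourier_sum)
  have bound: "norm (P N \<theta>) \<le> (\<Sum>n. norm (d n))\<^sup>2" for N \<theta>
  proof -
    have "norm (\<Sum>n<N. d n * cis (real n * \<theta>)) \<le> (\<Sum>n<N. norm (d n))"
      by (rule order_trans[OF norm_sum]) (simp add: norm_mult)
    also have "\<dots> \<le> (\<Sum>n. norm (d n))" by (rule sum_le_suminf[OF sm]) auto
    finally show ?thesis by (simp add: P_def power_mono)
  qed
  have lim: "(\<lambda>N. P N \<theta>) \<longlonglongrightarrow> f \<theta>" for \<theta>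
  proof -
    have "summable (\<lambda>n. d n * cis (real n * \<theta>))"
      by (rule summable_norm_cancel) (simp add: norm_mult sm)
    then show ?thesis
      unfolding P_def f_def by (intro tendsto_intros summable_LIMSEQ)
  qed
  have int: "f integrable_on {0..2 * pi}"
    "(\<lambda>N. integral {0..2 * pi} (P N)) \<longlonglongrightarrow> integral {0..2 * pi} f"
    using dominated_convergence[of P "{0..2 * pi}" "\<lambda>_. (\<Sum>n. norm (d n))\<^sup>2" f]
      has_integral_integrable[OF P] bound lim by auto
  have "(\<lambda>N. integral {0..2 * pi} (P N)) = (\<lambda>N. 2 * pi * (\<Sum>n<N. (norm (d n))\<^sup>2))"
    using integral_unique[OF P] by (rule ext)
  moreover have "(\<lambda>N. 2 * pi * (\<Sum>n<N. (norm (d n))\<^sup>2)) \<longlonglongrightarrow> 2 * pi * (\<Sum>n. (norm (d n))\<^sup>2)"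
    by (intro tendsto_intros summable_LIMSEQ summable_norm_square sm)
  ultimately have "integral {0..2 * pi} f = 2 * pi * (\<Sum>n. (norm (d n))\<^sup>2)"
    using int(2) LIMSEQ_unique by metis
  with int(1) show ?thesis unfolding f_def by (simp add: has_integral_iff)
qed

lemma powser_disc_abs_summable:
  fixes c :: "nat \<Rightarrow> complex" and r :: real
  assumes "\<And>z. norm z < 1 \<Longrightarrow> summable (\<lambda>n. c n * z ^ n)" "0 \<le> r" "r < 1"
  shows "summable (\<lambda>n. norm (c n) * r ^ n)"
proof -
  \<comment> \<open>Convergence at a point of larger modulus \<open>s\<close> forces absolute
    convergence at \<open>r\<close>.\<close>
  obtain s where s: "r < s" "s < 1" using dense assms(3) by blast
  have "summable (\<lambda>n. norm (c n * of_real r ^ n))"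
    by (rule powser_insidea[of c "of_real s"]) (use assms s in auto)
  then show ?thesis using assms by (simp add: norm_mult norm_power)
qed

text \<open>Parseval on the circle of radius \<open>r\<close> identifies each side, up to the factor
  \<open>2 * pi\<close>, with the integral of |F|^2 or |G|^2, so the pointwise bound only has to be
  integrated.\<close>

lemma powser_l2_mono:
  fixes c d :: "nat \<Rightarrow> complex"
  assumes F: "\<And>z. norm z < 1 \<Longrightarrow> (\<lambda>n. c n * z ^ n) sums F z"
    and G: "\<And>z. norm z < 1 \<Longrightarrow> (\<lambda>n. d n * z ^ n) sums G z"
    and le: "\<And>z. norm z < 1 \<Longrightarrow> norm (F z) \<le> norm (G z)"
    and r: "0 \<le> r" "r < 1"
  shows "(\<Sum>n. (norm (c n) * r ^ n)\<^sup>2) \<le> (\<Sum>n. (norm (d n) * r ^ n)\<^sup>2)"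
proof -
  have int: "((\<lambda>\<theta>. (norm (H (of_real r * cis \<theta>)))\<^sup>2) has_integral
      2 * pi * (\<Sum>n. (norm (e n) * r ^ n)\<^sup>2)) {0..2 * pi}"
    if H: "\<And>z. norm z < 1 \<Longrightarrow> (\<lambda>n. e n * z ^ n) sums H z" for e H
  proof -
    have "(\<Sum>n. e n * of_real r ^ n * cis (real n * \<theta>)) = H (of_real r * cis \<theta>)" for \<theta>
      using H[of "of_real r * cis \<theta>"] r
      by (simp add: sums_iff norm_mult power_mult_distrib Complex.DeMoivre mult.assoc [symmetric])
    moreover have "summable (\<lambda>n. norm (e n * of_real r ^ n))"
      using powser_disc_abs_summable[of e r] H r by (auto simp: sums_iff norm_mult norm_power)
    ultimately show ?thesis
      using has_integral_norm_square_fourier[of "\<lambda>n. e n * of_real r ^ n"] r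
      by (simp add: norm_mult norm_power)
  qed
  have "2 * pi * (\<Sum>n. (norm (c n) * r ^ n)\<^sup>2) \<le> 2 * pi * (\<Sum>n. (norm (d n) * r ^ n)\<^sup>2)"
    by (rule has_integral_le[OF int[OF F] int[OF G]])
       (use r le in \<open>auto simp: norm_mult intro!: power_mono\<close>)
  then show ?thesis by simp
qed

section \<open>Bounded analytic functions on the disc\<close>

lemma powser_disc_deriv_sums:
  fixes c :: "nat \<Rightarrow> complex"
  assumes F: "\<And>z. norm z < 1 \<Longrightarrow> (\<lambda>n. c n * z ^ n) sums F z" and "norm z < 1"
  shows "(\<lambda>n. diffs c n * z ^ n) sums deriv F z"
proof -
  have "((\<lambda>z. \<Sum>n. c n * z ^ n) has_field_derivative (\<Sum>n. diffs c n * z ^ n)) (at z)"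
    by (rule termdiffs_strong'[of 1]) (use assms in \<open>auto simp: sums_iff\<close>)
  moreover have "eventually (\<lambda>w. (\<Sum>n. c n * w ^ n) = F w) (nhds z)"
    using eventually_nhds_in_open[of "ball 0 1" z] assms(2)
    by (auto elim!: eventually_mono dest!: F simp: sums_iff)
  ultimately have "(F has_field_derivative (\<Sum>n. diffs c n * z ^ n)) (at z)"
    by (subst (asm) DERIV_cong_ev[OF refl _ refl]) auto
  moreover have "summable (\<lambda>n. diffs c n * z ^ n)"
    by (rule termdiff_converges[of _ 1]) (use assms in \<open>auto simp: sums_iff\<close>)
  ultimately show ?thesis by (simp add: DERIV_imp_deriv sums_iff)
qed

lemma bounded_powser_coeff_le:
  fixes c :: "nat \<Rightarrow> complex"
  assumes F: "\<And>z. norm z < 1 \<Longrightarrow> (\<lambda>n. c n * z ^ n) sums F z"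
    and le: "\<And>z. norm z < 1 \<Longrightarrow> norm (F z) \<le> 1"
    and n: "n \<ge> 1" and c0: "norm (c 0) < 1"
  shows "norm (c n) \<le> 1 - (norm (c 0))\<^sup>2"
proof -
  define A where "A = 1 - (norm (c 0))\<^sup>2"
  have A: "A > 0" using c0 by (simp add: A_def abs_square_less_1)
  \<comment> \<open>\<open>F z * (1 + \<beta> * z ^ n)\<close> is dominated by \<open>1 + \<beta> * z ^ n\<close>; comparing the coefficients of order
    \<open>0\<close> and \<open>n\<close> in the mean square, this \<open>\<beta>\<close> gives the strongest conclusion.\<close>
  define \<beta> where "\<beta> = cnj (c 0) * c n / of_real A"
  define e where "e j = c j + \<beta> * (if j < n then 0 else c (j - n))" for j
  define d where "d j = (if j = 0 then 1 else if j = n then \<beta> else 0)" for j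
  have e: "(\<lambda>j. e j * z ^ j) sums (F z * (1 + \<beta> * z ^ n))" if z: "norm z < 1" for z
  proof -
    \<comment> \<open>Multiplication by \<open>z ^ n\<close> shifts the coefficients of
      \<open>F\<close> by \<open>n\<close> places, with zeros in front.\<close>
    have "(\<lambda>j. if j < n then 0 else c (j - n) * z ^ (j - n)) sums F z"
      using sums_zero_iff_shift[of n "\<lambda>j. if j < n then 0 else c (j - n) * z ^ (j - n)"] F[OF z]
      by simp
    from sums_add[OF F[OF z] sums_mult[OF this, of "\<beta> * z ^ n"]]
    have "(\<lambda>j. c j * z ^ j + \<beta> * z ^ n * (if j < n then 0 else c (j - n) * z ^ (j - n))) sums
        (F z * (1 + \<beta> * z ^ n))"
      by (simp add: algebra_simps)
    moreover have "c j * z ^ j + \<beta> * z ^ n * (if j < n then 0 else c (j - n) * z ^ (j - n)) =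
        e j * z ^ j" for j
    proof (cases "j < n")
      case False
      then have "z ^ j = z ^ n * z ^ (j - n)" by (simp add: power_add [symmetric])
      with False show ?thesis by (simp add: e_def algebra_simps)
    qed (simp add: e_def)
    ultimately show ?thesis by simp
  qed
  have d: "(\<lambda>j. d j * z ^ j) sums (1 + \<beta> * z ^ n)" for z
  proof -
    have "(\<lambda>j. d j * z ^ j) sums (\<Sum>j\<in>{0, n}. d j * z ^ j)"
      by (rule sums_finite) (auto simp: d_def)
    then show ?thesis using n by (simp add: d_def)
  qed
  \<comment> \<open>On the left all but the entries 0 and \<open>n\<close> of the mean square are
    discarded; on the right these are the only entries that occur.\<close>
  have key: "(norm (c 0))\<^sup>2 + (norm (e n) * r ^ n)\<^sup>2 \<le> 1 + (norm \<beta> * r ^ n)\<^sup>2"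
    if r: "0 \<le> r" "r < 1" for r
  proof -
    have sm: "summable (\<lambda>j. (norm (e j) * r ^ j)\<^sup>2)"
      using summable_norm_square[of "\<lambda>j. norm (e j) * r ^ j"]
        powser_disc_abs_summable[of e r] e r by (auto simp: sums_iff)
    have "(norm (c 0))\<^sup>2 + (norm (e n) * r ^ n)\<^sup>2 = (\<Sum>j\<in>{0, n}. (norm (e j) * r ^ j)\<^sup>2)"
      using n by (simp add: e_def)
    also have "\<dots> \<le> (\<Sum>j. (norm (e j) * r ^ j)\<^sup>2)"
      by (rule sum_le_suminf[OF sm]) auto
    also have "\<dots> \<le> (\<Sum>j. (norm (d j) * r ^ j)\<^sup>2)"
      by (rule powser_l2_mono[OF e d _ r]) 
         (auto simp: norm_mult intro!: mult_left_le_one_le le)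
    also have "\<dots> = (\<Sum>j\<in>{0, n}. (norm (d j) * r ^ j)\<^sup>2)"
      by (rule suminf_finite) (auto simp: d_def)
    finally show ?thesis using n by (simp add: d_def)
  qed
  \<comment> \<open>Parseval is available only for \<open>r < 1\<close>. The limit from the left
    removes the powers of \<open>r\<close>; the form \<open>1 ^ n\<close> matches the limit
    literally.\<close>
  have "(norm (c 0))\<^sup>2 + (norm (e n) * 1 ^ n)\<^sup>2 \<le> 1 + (norm \<beta> * 1 ^ n)\<^sup>2"
  proof (rule tendsto_le[of "at_left (1::real)"])
    show "eventually (\<lambda>r. (norm (c 0))\<^sup>2 + (norm (e n) * r ^ n)\<^sup>2 \<le> 1 + (norm \<beta> * r ^ n)\<^sup>2)
        (at_left (1::real))"
      using eventually_at_left_real[of 0 "1::real"] by (auto elim!: eventually_mono intro: key)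
  qed (simp, (intro tendsto_intros)+)
  moreover have "e n = c n / of_real A"
  proof -
    have "e n = c n * (of_real A + c 0 * cnj (c 0)) / of_real A"
      using A by (simp add: e_def \<beta>_def field_simps)
    also have "of_real A + c 0 * cnj (c 0) = 1"
      by (simp add: A_def complex_norm_square [symmetric])
    finally show ?thesis by simp
  qed
  \<comment> \<open>With \<open>q\<close> the quotient |c n|^2 / A^2, this reads |c 0|^2 + q \<le> 1
    + |c 0|^2 q, that is A q \<le> A, hence q \<le> 1.\<close>
  ultimately have "(norm (c 0))\<^sup>2 + (norm (c n))\<^sup>2 / A\<^sup>2 \<le> 1 + (norm (c 0))\<^sup>2 * (norm (c n))\<^sup>2 / A\<^sup>2"
    using A by (simp add: \<beta>_def norm_mult norm_divide power_mult_distrib power_divide)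
  then have "(norm (c n))\<^sup>2 / A\<^sup>2 \<le> A + (1 - A) * (norm (c n))\<^sup>2 / A\<^sup>2"
    by (simp add: A_def)
  then have "A * (norm (c n))\<^sup>2 \<le> A * A\<^sup>2"
    using A by (simp add: field_simps power2_eq_square)
  then have "(norm (c n))\<^sup>2 \<le> A\<^sup>2" using A by simp
  then show ?thesis using A by (simp add: A_def power2_le_iff_abs_le)
qed

section \<open>The Schwarz--Pick inequalities\<close>

text \<open>Serves to eliminate the denominator |1 - cnj q * p| of the pseudo-hyperbolic distance,
  leaving only |p - q| and the moduli of \<open>p\<close> and \<open>q\<close>.\<close>

lemma norm_Schwarz_Pick_identity:
  fixes p q :: complex
  shows "(norm (1 - cnj q * p))\<^sup>2 - (norm (p - q))\<^sup>2 = (1 - (norm p)\<^sup>2) * (1 - (norm q)\<^sup>2)"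
  unfolding cmod_power2 by (simp add: algebra_simps power2_eq_square)

text \<open>Follow \<open>f\<close> by the disc automorphism that sends \<open>f 0\<close> to 0.
  Schwarz's lemma then bounds the pseudo-hyperbolic distance of \<open>f w\<close> and
  \<open>f 0\<close> by |w|. Replacing both values by their moduli does not increase that distance,
  and the resulting inequality can be solved for the modulus of \<open>f w\<close>.\<close>

lemma Schwarz_Pick_norm_le:
  assumes holf: "f holomorphic_on ball 0 1"
    and no: "\<And>z. norm z < 1 \<Longrightarrow> norm (f z) < 1" and w: "norm w < 1"
  shows "norm (f w) \<le> (norm w + norm (f 0)) / (1 + norm (f 0) * norm w)"
proof -
  define a P t where "a = norm (f 0)" and "P = norm (f w)" and "t = norm w"
  have b: "0 \<le> a" "a < 1" "0 \<le> P" "P < 1" "0 \<le> t" "t < 1"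
    using no[of 0] no[OF w] w by (auto simp: a_def P_def t_def)
  have le: "norm (Moebius_function 0 (f 0) (f w)) \<le> t"
  proof -
    have "(Moebius_function 0 (f 0) \<circ> f) holomorphic_on ball 0 1"
      by (rule holomorphic_on_compose_gen[OF holf Moebius_function_holomorphic])
         (use no in auto)
    moreover have "norm ((Moebius_function 0 (f 0) \<circ> f) z) < 1" if "norm z < 1" for z
      using Moebius_function_norm_lt_1[OF no[of 0] no[OF that]] by simp
    ultimately have "norm ((Moebius_function 0 (f 0) \<circ> f) w) \<le> norm w"
      using w by (intro Schwarz_Lemma(1)[of "Moebius_function 0 (f 0) \<circ> f"]) (auto simp: Moebius_function_eq_zero)
    then show ?thesis by (simp add: t_def)
  qed
  define M where "M = norm (1 - cnj (f 0) * f w)"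
  have "a * P \<le> a * 1" using b by (intro mult_left_mono) auto
  with b have aP: "a * P < 1" by simp
  have "norm (cnj (f 0) * f w) = a * P" by (simp add: norm_mult a_def P_def)
  with aP have "cnj (f 0) * f w \<noteq> 1" by (metis less_irrefl norm_one)
  then have M: "M > 0" by (simp add: M_def)
  have "norm (f w - f 0) \<le> t * M"
    using le M by (simp add: Moebius_function_simple norm_divide M_def field_simps)
  then have D: "(norm (f w - f 0))\<^sup>2 \<le> t\<^sup>2 * M\<^sup>2"
    by (metis norm_ge_zero power_mono power_mult_distrib)
  have id: "M\<^sup>2 = (norm (f w - f 0))\<^sup>2 + (1 - P\<^sup>2) * (1 - a\<^sup>2)"
    using norm_Schwarz_Pick_identity[of "f 0" "f w"] by (simp add: M_def P_def a_def)
  have "P - a \<le> t * (1 - a * P)"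
  proof (cases "P \<le> a")
    case True
    have "0 \<le> t * (1 - a * P)" using b aP by (intro mult_nonneg_nonneg) auto
    then show ?thesis using True by linarith
  next
    case False
    \<comment> \<open>Inserting \<open>id\<close> into \<open>D\<close> gives (1 - t^2) |f w - f
      0|^2 \<le> t^2 (1 - P^2) (1 - a^2). The smaller \<open>P - a\<close> may replace |f w - f 0|,
      and (1 - P^2) (1 - a^2) = (1 - a P)^2 - (P - a)^2 finishes.\<close>
    have "(P - a)\<^sup>2 \<le> (norm (f w - f 0))\<^sup>2"
      using norm_triangle_ineq2[of "f w" "f 0"] False by (intro power_mono) (auto simp: P_def a_def)
    moreover have "t\<^sup>2 \<le> 1" using b by (simp add: abs_square_le_1)
    ultimately have "(1 - t\<^sup>2) * (P - a)\<^sup>2 \<le> (1 - t\<^sup>2) * (norm (f w - f 0))\<^sup>2"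
      by (intro mult_left_mono) auto
    also have "\<dots> \<le> t\<^sup>2 * ((1 - P\<^sup>2) * (1 - a\<^sup>2))"
      using D unfolding id by (simp add: algebra_simps)
    finally have "(P - a)\<^sup>2 \<le> (t * (1 - a * P))\<^sup>2"
      by (simp add: power2_eq_square algebra_simps)
    then show ?thesis using b aP by (intro power2_le_imp_le[of "P - a"]) auto
  qed
  moreover have "0 < 1 + a * t" using b by (intro add_pos_nonneg) auto
  ultimately have "P \<le> (t + a) / (1 + a * t)" by (simp add: pos_le_divide_eq algebra_simps)
  then show ?thesis by (simp add: a_def P_def t_def)
qed

text \<open>Schwarz's lemma bounds the derivative at 0 of \<open>f\<close> conjugated by two
  automorphisms: \<phi> takes 0 to \<open>w\<close>, and \<psi> takes \<open>f w\<close> to 0. Their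
  derivatives at these points supply the factors 1 - |w|^2 and 1 / (1 - |f w|^2).\<close>

lemma Schwarz_Pick_deriv_le:
  assumes holf: "f holomorphic_on ball 0 1"
    and no: "\<And>z. norm z < 1 \<Longrightarrow> norm (f z) < 1" and w: "norm w < 1"
  shows "norm (deriv f w) * (1 - (norm w)\<^sup>2) \<le> 1 - (norm (f w))\<^sup>2"
proof -
  define \<phi> where "\<phi> = Moebius_function 0 (- w)"
  define \<psi> where "\<psi> = Moebius_function 0 (f w)"
  have pos: "1 - (norm (f w))\<^sup>2 > 0" "1 - (norm w)\<^sup>2 > 0"
    using no[OF w] w by (auto simp: abs_square_less_1)
  have \<phi>0: "\<phi> 0 = w" by (simp add: \<phi>_def Moebius_function_of_zero)
  have \<phi>1: "norm (\<phi> z) < 1" if "norm z < 1" for z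
    unfolding \<phi>_def using Moebius_function_norm_lt_1 w that by auto
  have hol: "(\<psi> \<circ> (f \<circ> \<phi>)) holomorphic_on ball 0 1"
    unfolding \<phi>_def \<psi>_def
    by (intro holomorphic_on_compose_gen[of _ _ _ "ball 0 1"] Moebius_function_holomorphic holf)
       (use w no \<phi>1 in \<open>auto simp: \<phi>_def\<close>)
  have "norm (deriv (\<psi> \<circ> (f \<circ> \<phi>)) 0) \<le> 1"
    by (rule Schwarz_Lemma(2)[OF hol, of 0])
       (use no w \<phi>1 \<phi>0 in \<open>auto simp: \<psi>_def Moebius_function_eq_zero intro!: Moebius_function_norm_lt_1\<close>)
  moreover have "((\<psi> \<circ> (f \<circ> \<phi>)) has_field_derivative
      (1 / of_real (1 - (norm (f w))\<^sup>2) * (deriv f w * of_real (1 - (norm w)\<^sup>2)))) (at 0)"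
  proof (intro DERIV_chain)
    show "(\<phi> has_field_derivative of_real (1 - (norm w)\<^sup>2)) (at 0)"
      unfolding \<phi>_def Moebius_function_simple
      by (auto intro!: derivative_eq_intros simp: complex_norm_square algebra_simps simp flip: of_real_power)
    show "(f has_field_derivative deriv f w) (at (\<phi> 0))"
      using holf w by (auto simp: \<phi>0 intro!: holomorphic_derivI[of _ "ball 0 1"])
    have nz: "1 - cnj (f w) * f w = of_real (1 - (norm (f w))\<^sup>2)"
      by (simp add: complex_norm_square mult.commute flip: of_real_power)
    then have "1 - cnj (f w) * f w \<noteq> 0" using pos by (metis of_real_eq_0_iff less_irrefl)
    then have "(\<psi> has_field_derivative 1 / (1 - cnj (f w) * f w)) (at (f w))"
      unfolding \<psi>_def Moebius_function_simple
      by (auto intro!: derivative_eq_intros simp: divide_simps)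
    then show "(\<psi> has_field_derivative 1 / of_real (1 - (norm (f w))\<^sup>2)) (at ((f \<circ> \<phi>) 0))"
      by (simp add: nz \<phi>0)
  qed
  ultimately have "norm (1 / of_real (1 - (norm (f w))\<^sup>2) * (deriv f w * of_real (1 - (norm w)\<^sup>2))) \<le> 1"
    by (simp only: DERIV_imp_deriv)
  then have "norm (deriv f w) * (1 - (norm w)\<^sup>2) / (1 - (norm (f w))\<^sup>2) \<le> 1"
    using pos by (simp add: norm_mult norm_divide del: of_real_diff of_real_power)
  then show ?thesis using pos by (simp add: divide_simps)
qed

section \<open>Dominated derivatives\<close>

lemma sqrt_power_square: "0 \<le> x \<Longrightarrow> (sqrt x ^ n)\<^sup>2 = x ^ n"
  by (metis mult.commute power_mult real_sqrt_pow2)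

text \<open>A factor \<open>n\<close> on the coefficients is the operator x d/dx, so such factors
  can be removed by integration.\<close>

lemma powser_of_nat_mult_sums:
  fixes d :: "nat \<Rightarrow> real"
  assumes sm: "\<And>x. 0 \<le> x \<Longrightarrow> x < 1 \<Longrightarrow> summable (\<lambda>n. d n * x ^ n)"
    and x: "0 \<le> x" "x < 1"
  shows "(\<lambda>n. real n * d n * x ^ n) sums (x * (\<Sum>n. diffs d n * x ^ n))"
    and "((\<lambda>x. \<Sum>n. d n * x ^ n) has_real_derivative (\<Sum>n. diffs d n * x ^ n)) (at x)"
proof -
  obtain s where s: "x < s" "s < 1" using dense x(2) by blast
  have s': "summable (\<lambda>n. d n * s ^ n)" "norm x < norm s" using sm[of s] s x by auto
  have "summable (\<lambda>n. diffs d n * x ^ n)"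
    by (rule termdiff_converges[of _ "norm s"]) (use s' in \<open>auto intro: powser_inside\<close>)
  from sums_mult[OF diffs_equiv[OF this], of x]
  have "(\<lambda>n. x * (real n * d n * x ^ (n - Suc 0))) sums (x * (\<Sum>n. diffs d n * x ^ n))"
    by simp
  moreover have "x * (real n * d n * x ^ (n - Suc 0)) = real n * d n * x ^ n" for n
    by (cases n) auto
  ultimately show "(\<lambda>n. real n * d n * x ^ n) sums (x * (\<Sum>n. diffs d n * x ^ n))" by simp
  show "((\<lambda>x. \<Sum>n. d n * x ^ n) has_real_derivative (\<Sum>n. diffs d n * x ^ n)) (at x)"
    by (rule termdiffs_strong[OF s'])
qed

text \<open>The hypothesis says that x f'(x) is nonnegative for the sum f of the series. Hence f
  does not decrease from its value \<open>d 0\<close> at 0, by the mean value theorem.\<close>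

lemma powser_nonneg_integrate:
  fixes d :: "nat \<Rightarrow> real"
  assumes sm: "\<And>x. 0 \<le> x \<Longrightarrow> x < 1 \<Longrightarrow> summable (\<lambda>n. d n * x ^ n)"
    and nn: "\<And>x. 0 < x \<Longrightarrow> x < 1 \<Longrightarrow> 0 \<le> (\<Sum>n. real n * d n * x ^ n)"
    and d0: "0 \<le> d 0" and x: "0 \<le> x" "x < 1"
  shows "0 \<le> (\<Sum>n. d n * x ^ n)"
proof (cases "x = 0")
  case True
  then show ?thesis using d0 by simp
next
  case False
  define f where "f x = (\<Sum>n. d n * x ^ n)" for x
  have "\<exists>y>0. y < x \<and> f x - f 0 = (x - 0) * (\<Sum>n. diffs d n * y ^ n)"
    unfolding f_def
  proof (rule MVT2)
    fix y assume "0 \<le> y" "y \<le> x"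
    then show "((\<lambda>x. \<Sum>n. d n * x ^ n) has_real_derivative (\<Sum>n. diffs d n * y ^ n)) (at y)"
      using powser_of_nat_mult_sums(2)[OF sm, of y] x by simp
  qed (use False x in simp)
  then obtain y where y: "0 < y" "y < x" "f x - f 0 = x * (\<Sum>n. diffs d n * y ^ n)" by auto
  have "(\<Sum>n. real n * d n * y ^ n) = y * (\<Sum>n. diffs d n * y ^ n)"
    using powser_of_nat_mult_sums(1)[of d y] sm y x by (simp add: sums_iff)
  with nn[of y] y x have "0 \<le> (\<Sum>n. diffs d n * y ^ n)"
    by (simp add: zero_le_mult_iff)
  then have "f 0 \<le> f x" using y x mult_nonneg_nonneg[of x "\<Sum>n. diffs d n * y ^ n"] by linarith
  moreover have "f 0 = d 0" by (simp add: f_def)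
  ultimately show ?thesis using d0 by (simp add: f_def)
qed

text \<open>Parseval for g' and k h' on the circle of radius \<open>sqrt y\<close> gives the
  comparison with additional weights n^2. Two applications of \<open>powser_nonneg_integrate\<close>
  in the variable \<open>y\<close> strip the two factors \<open>n\<close>.\<close>

lemma powser_deriv_dominated_l2:
  fixes a b :: "nat \<Rightarrow> complex"
  assumes h: "\<And>z. norm z < 1 \<Longrightarrow> (\<lambda>n. a n * z ^ n) sums h z"
    and g: "\<And>z. norm z < 1 \<Longrightarrow> (\<lambda>n. b n * z ^ n) sums g z"
    and le: "\<And>z. norm z < 1 \<Longrightarrow> norm (deriv g z) \<le> k * norm (deriv h z)"
    and k: "0 \<le> k" and x: "0 \<le> x" "x < 1"
  shows "summable (\<lambda>n. (norm (a (n + 1)))\<^sup>2 * x ^ (n + 1))"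
    and "summable (\<lambda>n. (norm (b (n + 1)))\<^sup>2 * x ^ (n + 1))"
    and "(\<Sum>n. (norm (b (n + 1)))\<^sup>2 * x ^ (n + 1)) \<le> k\<^sup>2 * (\<Sum>n. (norm (a (n + 1)))\<^sup>2 * x ^ (n + 1))"
proof -
  have sq: "summable (\<lambda>n. (norm (c n))\<^sup>2 * x ^ n)"
    if "\<And>z. norm z < 1 \<Longrightarrow> (\<lambda>n. c n * z ^ n) sums F z" "0 \<le> x" "x < 1" for c :: "nat \<Rightarrow> complex" and F x
  proof -
    have eq: "(\<lambda>n. (norm (c n))\<^sup>2 * x ^ n) = (\<lambda>n. (norm (c n) * sqrt x ^ n)\<^sup>2)"
      using that by (simp only: power_mult_distrib sqrt_power_square)
    show "summable (\<lambda>n. (norm (c n))\<^sup>2 * x ^ n)"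
      unfolding eq
      using summable_norm_square[of "\<lambda>n. norm (c n) * sqrt x ^ n"]
        powser_disc_abs_summable[of c "sqrt x"] that by (auto simp: sums_iff)
  qed
  show sa: "summable (\<lambda>n. (norm (a (n + 1)))\<^sup>2 * x ^ (n + 1))"
    using summable_ignore_initial_segment[OF sq[OF h x], of 1] by simp
  show sb: "summable (\<lambda>n. (norm (b (n + 1)))\<^sup>2 * x ^ (n + 1))"
    using summable_ignore_initial_segment[OF sq[OF g x], of 1] by simp
  \<comment> \<open>The entry 0 vanishes because derivatives do not see the constant terms; it also
    provides the nonnegative starting value for the integrations.\<close>
  define e where "e n = (if n = 0 then 0 else k\<^sup>2 * (norm (a n))\<^sup>2 - (norm (b n))\<^sup>2)" for n
  have e: "summable (\<lambda>n. e n * y ^ n)" if "0 \<le> y" "y < 1" for y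
  proof -
    have "summable (\<lambda>n. k\<^sup>2 * ((norm (a n))\<^sup>2 * y ^ n) - (norm (b n))\<^sup>2 * y ^ n)"
      by (intro summable_diff summable_mult sq[OF h] sq[OF g] that)
    then have "summable (\<lambda>n. e (Suc n) * y ^ Suc n)"
      unfolding e_def by (subst (asm) summable_Suc_iff [symmetric]) (simp add: algebra_simps)
    then show ?thesis by (subst (asm) summable_Suc_iff)
  qed
  have ne: "summable (\<lambda>n. real n * e n * y ^ n)" if "0 \<le> y" "y < 1" for y
    using powser_of_nat_mult_sums(1)[of e y] e that by (auto simp: sums_iff)
  have nne: "0 \<le> (\<Sum>n. real n * (real n * e n) * y ^ n)" if y: "0 < y" "y < 1" for y
  proof -
    have h': "(\<lambda>n. (of_real k * diffs a n) * z ^ n) sums (of_real k * deriv h z)" if "norm z < 1" for z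
      using sums_mult[OF powser_disc_deriv_sums[OF h that], of "of_real k"] by (simp add: mult.assoc)
    note g' = powser_disc_deriv_sums[OF g]
    have y': "0 \<le> y" "0 \<le> sqrt y" "sqrt y < 1" using y by auto
    have "(\<Sum>n. (norm (diffs b n) * sqrt y ^ n)\<^sup>2) \<le> (\<Sum>n. (norm (of_real k * diffs a n) * sqrt y ^ n)\<^sup>2)"
      by (rule powser_l2_mono[OF g' h']) (use y' le k in \<open>auto simp: norm_mult\<close>)
    then have "0 \<le> (\<Sum>n. (norm (of_real k * diffs a n))\<^sup>2 * y ^ n) - (\<Sum>n. (norm (diffs b n))\<^sup>2 * y ^ n)"
      using y'(1) by (simp add: power_mult_distrib sqrt_power_square)
    also have "\<dots> = (\<Sum>n. (norm (of_real k * diffs a n))\<^sup>2 * y ^ n - (norm (diffs b n))\<^sup>2 * y ^ n)"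
      by (rule suminf_diff[OF sq[OF h' y'(1) y(2)] sq[OF g' y'(1) y(2)]])
    \<comment> \<open>\<open>diffs\<close> places the coefficient of index \<open>n + 1\<close> at
      \<open>y ^ n\<close>; the extra factor \<open>y\<close> restores the original
      exponent.\<close>
    finally have nn: "0 \<le> y * (\<Sum>n. (norm (of_real k * diffs a n))\<^sup>2 * y ^ n - (norm (diffs b n))\<^sup>2 * y ^ n)"
      using y by simp
    have "(\<lambda>n. y * ((norm (of_real k * diffs a n))\<^sup>2 * y ^ n - (norm (diffs b n))\<^sup>2 * y ^ n)) sums
        (y * (\<Sum>n. (norm (of_real k * diffs a n))\<^sup>2 * y ^ n - (norm (diffs b n))\<^sup>2 * y ^ n))"
      by (intro sums_mult summable_sums summable_diff sq[OF h' y'(1) y(2)] sq[OF g' y'(1) y(2)])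
    moreover have "y * ((norm (of_real k * diffs a n))\<^sup>2 * y ^ n - (norm (diffs b n))\<^sup>2 * y ^ n) =
        real (Suc n) * (real (Suc n) * e (Suc n)) * y ^ Suc n" for n
      by (simp add: diffs_def e_def norm_mult power_mult_distrib power2_eq_square algebra_simps
          del: of_nat_Suc)
    ultimately have "(\<lambda>n. real n * (real n * e n) * y ^ n) sums
        (y * (\<Sum>n. (norm (of_real k * diffs a n))\<^sup>2 * y ^ n - (norm (diffs b n))\<^sup>2 * y ^ n) + 0)"
      using sums_Suc[of "\<lambda>n. real n * (real n * e n) * y ^ n"] by simp
    with nn show ?thesis by (simp add: sums_iff)
  qed
  \<comment> \<open>The first integration is carried out for every \<open>y\<close> in the unit
    interval, since the second one needs its outcome on the whole range below
    \<open>x\<close>.\<close>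
  have "0 \<le> (\<Sum>n. real n * e n * y ^ n)" if "0 \<le> y" "y < 1" for y
    by (rule powser_nonneg_integrate[OF ne nne]) (use that in \<open>auto simp: mult.assoc\<close>)
  then have "0 \<le> (\<Sum>n. e n * x ^ n)"
    by (intro powser_nonneg_integrate[OF e]) (use x in \<open>auto simp: e_def\<close>)
  also have "\<dots> = (\<Sum>n. e (Suc n) * x ^ Suc n)"
    using suminf_split_head[OF e[OF x]] by (simp add: e_def)
  also have "\<dots> = (\<Sum>n. k\<^sup>2 * ((norm (a (n + 1)))\<^sup>2 * x ^ (n + 1)) - (norm (b (n + 1)))\<^sup>2 * x ^ (n + 1))"
    by (simp add: e_def algebra_simps)
  also have "\<dots> = (\<Sum>n. k\<^sup>2 * ((norm (a (n + 1)))\<^sup>2 * x ^ (n + 1))) - (\<Sum>n. (norm (b (n + 1)))\<^sup>2 * x ^ (n + 1))"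
    by (rule suminf_diff[OF summable_mult[OF sa] sb, symmetric])
  also have "(\<Sum>n. k\<^sup>2 * ((norm (a (n + 1)))\<^sup>2 * x ^ (n + 1))) = k\<^sup>2 * (\<Sum>n. (norm (a (n + 1)))\<^sup>2 * x ^ (n + 1))"
    by (rule suminf_mult[OF sa])
  finally show "(\<Sum>n. (norm (b (n + 1)))\<^sup>2 * x ^ (n + 1)) \<le> k\<^sup>2 * (\<Sum>n. (norm (a (n + 1)))\<^sup>2 * x ^ (n + 1))"
    by simp
qed

lemma geometric_tail_sums:
  fixes r :: real
  assumes "0 \<le> r" "r < 1"
  shows "(\<lambda>n. r ^ (n + j)) sums (r ^ j / (1 - r))"
  using sums_mult[OF geometric_sums[of r], of "r ^ j"] assms by (simp add: power_add mult_ac)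

text \<open>Cauchy--Schwarz with the weight \<open>r ^ n\<close> split into two equal square roots:
  the mean square of \<open>b\<close> is at most k^2 A^2 S and the weights sum to \<open>S\<close>,
  so the product of the two is (k A S)^2.\<close>

lemma powser_deriv_dominated_abs_sum_le:
  fixes a b :: "nat \<Rightarrow> complex"
  assumes h: "\<And>z. norm z < 1 \<Longrightarrow> (\<lambda>n. a n * z ^ n) sums h z"
    and g: "\<And>z. norm z < 1 \<Longrightarrow> (\<lambda>n. b n * z ^ n) sums g z"
    and le: "\<And>z. norm z < 1 \<Longrightarrow> norm (deriv g z) \<le> k * norm (deriv h z)"
    and A: "\<And>n. n \<ge> 1 \<Longrightarrow> norm (a n) \<le> A"
    and k: "0 \<le> k" and r: "0 \<le> r" "r < 1"
  shows "(\<Sum>n. norm (b (n + 1)) * r ^ (n + 1)) \<le> k * A * (r / (1 - r))"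
proof -
  define S where "S = r / (1 - r)"
  have S: "0 \<le> S" using r by (simp add: S_def)
  have A0: "0 \<le> A" using A[of 1] norm_ge_zero order_trans by blast
  have geo: "(\<lambda>n. r ^ (n + 1)) sums S"
    using geometric_tail_sums[OF r, of 1] by (simp add: S_def)
  note l2 = powser_deriv_dominated_l2[OF h g le k r]
  have "(\<Sum>n. (norm (a (n + 1)))\<^sup>2 * r ^ (n + 1)) \<le> (\<Sum>n. A\<^sup>2 * r ^ (n + 1))"
    by (intro suminf_le l2 summable_mult sums_summable[OF geo])
       (use r in \<open>auto intro!: mult_right_mono power_mono A\<close>)
  also have "\<dots> = A\<^sup>2 * S"
    using suminf_mult[OF sums_summable[OF geo]] geo by (simp add: sums_iff)
  finally have "k\<^sup>2 * (\<Sum>n. (norm (a (n + 1)))\<^sup>2 * r ^ (n + 1)) \<le> k\<^sup>2 * (A\<^sup>2 * S)"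
    by (intro mult_left_mono) auto
  with l2(3) have B: "(\<Sum>n. (norm (b (n + 1)))\<^sup>2 * r ^ (n + 1)) \<le> k\<^sup>2 * (A\<^sup>2 * S)" by linarith
  have "(\<Sum>n<N. norm (b (n + 1)) * r ^ (n + 1)) \<le> k * A * S" for N
  proof (rule power2_le_imp_le)
    have "(\<Sum>n<N. norm (b (n + 1)) * r ^ (n + 1))\<^sup>2 =
        (\<Sum>n<N. (norm (b (n + 1)) * sqrt r ^ (n + 1)) * sqrt r ^ (n + 1))\<^sup>2"
      using r by (simp add: mult.assoc power_mult_distrib [symmetric] del: power_Suc)
    also have "\<dots> \<le> (\<Sum>n<N. (norm (b (n + 1)) * sqrt r ^ (n + 1))\<^sup>2) * (\<Sum>n<N. (sqrt r ^ (n + 1))\<^sup>2)"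
      by (rule Cauchy_Schwarz_ineq_sum)
    also have "\<dots> = (\<Sum>n<N. (norm (b (n + 1)))\<^sup>2 * r ^ (n + 1)) * (\<Sum>n<N. r ^ (n + 1))"
      by (simp only: power_mult_distrib sqrt_power_square[OF r(1)])
    also have "\<dots> \<le> (k\<^sup>2 * (A\<^sup>2 * S)) * S"
    proof (rule mult_mono)
      show "(\<Sum>n<N. (norm (b (n + 1)))\<^sup>2 * r ^ (n + 1)) \<le> k\<^sup>2 * (A\<^sup>2 * S)"
        by (rule order_trans[OF sum_le_suminf[OF l2(2)] B]) (use r in auto)
      have "(\<Sum>n<N. r ^ (n + 1)) \<le> (\<Sum>n. r ^ (n + 1))"
        by (rule sum_le_suminf[OF sums_summable[OF geo]]) (use r in auto)
      then show "(\<Sum>n<N. r ^ (n + 1)) \<le> S" using geo by (simp add: sums_iff)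
    qed (use S r in \<open>auto intro!: sum_nonneg\<close>)
    also have "\<dots> = (k * A * S)\<^sup>2" by (simp add: power2_eq_square mult_ac)
    finally show "(\<Sum>n<N. norm (b (n + 1)) * r ^ (n + 1))\<^sup>2 \<le> (k * A * S)\<^sup>2" .
  qed (use k A0 S in simp)
  moreover have "summable (\<lambda>n. norm (b (n + 1)) * r ^ (n + 1))"
    using summable_ignore_initial_segment[OF powser_disc_abs_summable[of b r], of 1] g r
    by (auto simp: sums_iff)
  ultimately show ?thesis unfolding S_def by (intro suminf_le_const)
qed

section \<open>The Bohr inequality and its sharpness\<close>

text \<open>Splits off a positive factor so that the sign of \<Lambda> is that of the last bracket,
  whose terms are all nondecreasing in \<open>r\<close>.\<close>

lemma Lam_factor:
  assumes "0 \<le> r" "r < 1"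
  shows "\<Lambda> m k r = (1 - r) * (1 + r ^ m)\<^sup>2 * (1 - 2 / (1 + r ^ m)\<^sup>2 + 2 * (r * (r + k) / (1 - r)))"
proof -
  define t where "t = r ^ m"
  have t: "1 + t \<noteq> 0" using assms by (simp add: t_def add_nonneg_eq_0_iff)
  have r2: "r ^ (2 * m) = t\<^sup>2" by (simp add: t_def power_mult mult.commute)
  have "(1 - r) * (1 + t)\<^sup>2 * (1 - 2 / (1 + t)\<^sup>2 + 2 * (r * (r + k) / (1 - r))) =
      (1 - r) * ((1 + t)\<^sup>2 - 2) + 2 * r * (r + k) * (1 + t)\<^sup>2"
    using t assms by (simp add: field_simps)
  also have "\<dots> = \<Lambda> m k r"
    unfolding Lam_def r2 t_def [symmetric] by (simp add: power2_eq_square algebra_simps)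
  finally show ?thesis by (simp add: t_def)
qed

text \<open>The Bohr radius is given only as a root of \<Lambda>; this carries the condition
  \<Lambda> \<le> 0 from the root down to all smaller radii.\<close>

lemma Lam_sign_mono:
  assumes "0 \<le> k" "0 \<le> r" "r \<le> s" "s < 1" and "\<Lambda> m k s \<le> 0"
  shows "\<Lambda> m k r \<le> 0"
proof -
  define Q where "Q r = 1 - 2 / (1 + r ^ m)\<^sup>2 + 2 * (r * (r + k) / (1 - r))" for r
  have fac: "\<Lambda> m k x = (1 - x) * (1 + x ^ m)\<^sup>2 * Q x" and pos: "0 < (1 - x) * (1 + x ^ m)\<^sup>2"
    if "0 \<le> x" "x < 1" for x
    using Lam_factor[OF that, of m k] that add_pos_nonneg[OF zero_less_one zero_le_power[OF that(1), of m]]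
    by (auto simp: Q_def)
  have sign: "\<Lambda> m k x \<le> 0 \<longleftrightarrow> Q x \<le> 0" if "0 \<le> x" "x < 1" for x
    using fac[OF that] mult_le_cancel_left_pos[OF pos[OF that], of "Q x" 0] by simp
  have "Q s \<le> 0"
    using assms sign[of s] by simp
  moreover have "Q r \<le> Q s"
  proof -
    have "2 / (1 + s ^ m)\<^sup>2 \<le> 2 / (1 + r ^ m)\<^sup>2"
    proof (intro frac_le power_mono add_left_mono zero_less_power)
      show "0 < 1 + r ^ m" using assms by (intro add_pos_nonneg) auto
    qed (use assms in auto)
    moreover have "r * (r + k) / (1 - r) \<le> s * (s + k) / (1 - s)"
      using assms by (intro frac_le mult_mono) auto
    ultimately show ?thesis by (simp add: Q_def)
  qed
  ultimately show ?thesis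
    using assms sign[of r] by simp
qed

text \<open>Since \<Lambda> is positive at 1, a nonpositive value at \<open>r\<close> would force a
  root between \<open>r\<close> and 1, beyond the greatest one.\<close>

lemma Lam_pos_beyond_bohr_radius:
  assumes "m \<ge> 1" "0 \<le> k" "bohr_radius m k < r" "r < 1"
  shows "0 < \<Lambda> m k r"
proof (rule ccontr)
  assume "\<not> ?thesis"
  then have "\<Lambda> m k r \<le> 0" by simp
  moreover have "0 \<le> \<Lambda> m k 1" using Lam_pos[of k 1 m] assms by simp
  moreover have "continuous_on {r..1} (\<Lambda> m k)"
    unfolding Lam_def by (intro continuous_intros)
  ultimately obtain x where "r \<le> x" "\<Lambda> m k x = 0"
    using IVT'[of "\<Lambda> m k" r 0 1] assms by auto
  then show False
    using bohr_radius_greatest_root(1)[OF assms(1,2)] bohr_radius_greatest_root(4)[OF assms(1,2), of x] assms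
    by linarith
qed

section \<open>Real inequalities behind the Bohr sum\<close>

text \<open>The bracket on the left is the head of the Bohr sum for the automorphism (z + a) / (1 +
  a z) at \<open>t\<close>. Its distance from 1 contains the factor \<open>1 - a\<close>, as do the
  tail bounds through 1 - a^2, so this factor cancels and the comparison survives as
  \<open>a\<close> tends to 1.\<close>

lemma one_minus_bohr_head:
  fixes a t :: real
  assumes "0 \<le> a" "0 \<le> t"
  shows "1 - ((t + a) / (1 + a * t) + t * ((1 - a\<^sup>2) / (1 + a * t)\<^sup>2)) =
    (1 - a) * ((1 - 2 * t - a * t\<^sup>2) / (1 + a * t)\<^sup>2)"
proof -
  have d: "1 + a * t \<noteq> 0" using assms by (simp add: add_nonneg_eq_0_iff)
  have "(t + a) / (1 + a * t) = (t + a) * (1 + a * t) / (1 + a * t)\<^sup>2"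
    using d by (simp add: power2_eq_square)
  moreover have "1 = (1 + a * t)\<^sup>2 / (1 + a * t)\<^sup>2" using d by simp
  ultimately have "1 - ((t + a) / (1 + a * t) + t * ((1 - a\<^sup>2) / (1 + a * t)\<^sup>2)) =
      ((1 + a * t)\<^sup>2 - (t + a) * (1 + a * t) - t * (1 - a\<^sup>2)) / (1 + a * t)\<^sup>2"
    by (simp add: diff_divide_distrib right_diff_distrib)
  also have "(1 + a * t)\<^sup>2 - (t + a) * (1 + a * t) - t * (1 - a\<^sup>2) = (1 - a) * (1 - 2 * t - a * t\<^sup>2)"
    by (simp add: power2_eq_square algebra_simps)
  finally show ?thesis by simp
qed

text \<open>Schwarz--Pick for the derivative reduces the head to P + u (1 - P^2) with u = t / (1 -
  t^2). This is nondecreasing in \<open>P\<close> on the unit interval as soon as 2 u \<le> 1, which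
  is the condition 2 t \<le> 1 - t^2; so \<open>P\<close> may be replaced by its upper
  bound.\<close>

lemma bohr_head_le:
  fixes a t P D :: real
  assumes a: "0 \<le> a" "a < 1" and t: "0 \<le> t" "2 * t \<le> 1 - t\<^sup>2"
    and P: "0 \<le> P" "P \<le> (t + a) / (1 + a * t)" and D: "D * (1 - t\<^sup>2) \<le> 1 - P\<^sup>2"
  shows "P + t * D \<le> (t + a) / (1 + a * t) + t * ((1 - a\<^sup>2) / (1 + a * t)\<^sup>2)"
proof -
  define x where "x = (t + a) / (1 + a * t)"
  have d: "0 < 1 + a * t" using a t by (intro add_pos_nonneg) auto
  have t2: "0 < 1 - t\<^sup>2"
  proof (cases "t = 0")
    case False
    with t show ?thesis by linarith
  qed simp
  then have t1: "t < 1" using t by (metis abs_of_nonneg abs_square_less_1 diff_gt_0_iff_gt)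
  define u where "u = t / (1 - t\<^sup>2)"
  have u: "0 \<le> u" "2 * u \<le> 1" using t t2 by (auto simp: u_def field_simps)
  have x1: "x \<le> 1"
    using mult_nonneg_nonneg[of "1 - a" "1 - t"] a t1 d by (simp add: x_def field_simps)
  have "D \<le> (1 - P\<^sup>2) / (1 - t\<^sup>2)" using D t2 by (simp add: field_simps)
  then have "t * D \<le> t * ((1 - P\<^sup>2) / (1 - t\<^sup>2))" using t by (intro mult_left_mono)
  then have tD: "t * D \<le> u * (1 - P\<^sup>2)" by (simp add: u_def)
  have "u * (x + P) \<le> u * 2" using u x1 P by (intro mult_left_mono) (auto simp: x_def)
  \<comment> \<open>This product is the increase of P + u (1 - P^2) when \<open>P\<close> is raised
    to \<open>x\<close>.\<close>
  then have "0 \<le> (x - P) * (1 - u * (x + P))"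
    using u P by (intro mult_nonneg_nonneg) (auto simp: x_def)
  then have "P + u * (1 - P\<^sup>2) \<le> x + u * (1 - x\<^sup>2)"
    by (simp add: power2_eq_square algebra_simps)
  moreover have "u * (1 - x\<^sup>2) = t * ((1 - a\<^sup>2) / (1 + a * t)\<^sup>2)"
  proof -
    have "(1 + a * t)\<^sup>2 - (t + a)\<^sup>2 = (1 - a\<^sup>2) * (1 - t\<^sup>2)"
      by (simp add: power2_eq_square algebra_simps)
    moreover have "1 - x\<^sup>2 = ((1 + a * t)\<^sup>2 - (t + a)\<^sup>2) / (1 + a * t)\<^sup>2"
      using d by (simp add: x_def power_divide diff_divide_distrib)
    ultimately show ?thesis using t2 by (simp add: u_def)
  qed
  ultimately show ?thesis using tD by (simp add: x_def)
qed

text \<open>After cancelling \<open>1 - a\<close>, the hypothesis \<open>L\<close> is the case a =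
  1. It implies the other cases because 1 + a and (1 + a t)^2 are largest, and 1 - 2 t - a t^2 is
  smallest, at a = 1.\<close>

lemma bohr_real_inequality:
  fixes a t r k :: real
  assumes a: "0 \<le> a" "a < 1" and t: "0 \<le> t" and r: "0 \<le> r" "r < 1" and k: "0 \<le> k"
    and L: "2 * (r * (r + k)) * (1 + t)\<^sup>2 \<le> (1 - r) * (1 - 2 * t - t\<^sup>2)"
  shows "(t + a) / (1 + a * t) + t * ((1 - a\<^sup>2) / (1 + a * t)\<^sup>2)
    + (1 - a\<^sup>2) * (r\<^sup>2 / (1 - r)) + k * (1 - a\<^sup>2) * (r / (1 - r)) \<le> 1"
proof -
  have d: "0 < 1 + a * t" using a t by (intro add_pos_nonneg) auto
  have at: "a * t \<le> t" "a * t\<^sup>2 \<le> t\<^sup>2" using a t by (auto intro!: mult_left_le_one_le)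
  have "(1 + a) * (r * (r + k)) * (1 + a * t)\<^sup>2 \<le> 2 * (r * (r + k)) * (1 + t)\<^sup>2"
    using a t r k d at by (intro mult_mono power_mono) auto
  also note L
  also have "(1 - r) * (1 - 2 * t - t\<^sup>2) \<le> (1 - r) * (1 - 2 * t - a * t\<^sup>2)"
    using r at by (intro mult_left_mono) auto
  finally have "(1 + a) * (r * (r + k) / (1 - r)) \<le> (1 - 2 * t - a * t\<^sup>2) / (1 + a * t)\<^sup>2"
    using d r by (simp add: field_simps)
  then have "(1 - a) * ((1 + a) * (r * (r + k) / (1 - r))) \<le>
      (1 - a) * ((1 - 2 * t - a * t\<^sup>2) / (1 + a * t)\<^sup>2)"
    using a by (intro mult_left_mono) auto
  also have "\<dots> = 1 - ((t + a) / (1 + a * t) + t * ((1 - a\<^sup>2) / (1 + a * t)\<^sup>2))"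
    using one_minus_bohr_head[OF a(1) t] by simp
  also have "(1 - a) * ((1 + a) * (r * (r + k) / (1 - r))) =
      (1 - a\<^sup>2) * (r\<^sup>2 / (1 - r)) + k * (1 - a\<^sup>2) * (r / (1 - r))"
    using r by (simp add: divide_simps) (simp add: power2_eq_square algebra_simps)
  finally show ?thesis by simp
qed

lemma bohr_sum_le_one:
  assumes m: "m \<ge> 1" and k: "0 \<le> k"
    and hm: "harmonic_mapping f h g a b" and hB: "h \<in> \<B>"
    and dom: "\<And>z. z \<in> \<D> \<Longrightarrow> norm (deriv g z) \<le> k * norm (deriv h z)"
    and z: "norm z \<le> bohr_radius m k"
  shows "bohr_sum m h a b z \<le> 1"
proof -
  define r t \<alpha> where "r = norm z" and "t = r ^ m" and "\<alpha> = norm (a 0)"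
  note R = bohr_radius_greatest_root[OF m k]
  have r: "0 \<le> r" "r < 1" using z R(2) by (auto simp: r_def)
  have t: "0 \<le> t" "norm (z ^ m) = t" using r by (auto simp: t_def r_def norm_power)
  have w: "norm (z ^ m) < 1"
    using power_strict_mono[of r 1 m] r m by (simp add: t(2) t_def)
  have hol: "h holomorphic_on \<D>" and h1: "\<And>z. norm z < 1 \<Longrightarrow> norm (h z) < 1"
    using hB by (auto simp: class_B_def analytic_imp_holomorphic)
  have h: "\<And>z. norm z < 1 \<Longrightarrow> (\<lambda>n. a n * z ^ n) sums h z"
    using hm by (auto simp: harmonic_mapping_def)
  \<comment> \<open>The series of \<open>g\<close> starts at index 1; the value 0 at index 0
    completes it to a power series of the form required by the lemmas on dominated
    derivatives.\<close>
  define b' where "b' n = (if n = 0 then 0 else b n)" for n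
  have g: "(\<lambda>n. b' n * z ^ n) sums g z" if "norm z < 1" for z
  proof -
    have "(\<lambda>n. b' (Suc n) * z ^ Suc n) sums g z"
      using hm that by (auto simp: harmonic_mapping_def b'_def)
    from sums_Suc[OF this] show ?thesis by (simp add: b'_def)
  qed
  have "h 0 = a 0" using sums_unique2[OF h[of 0] powser_sums_zero] by simp
  then have \<alpha>: "norm (h 0) = \<alpha>" "0 \<le> \<alpha>" "\<alpha> < 1" using h1[of 0] by (auto simp: \<alpha>_def)
  have L: "2 * (r * (r + k)) * (1 + t)\<^sup>2 \<le> (1 - r) * (1 - 2 * t - t\<^sup>2)"
  proof -
    have "\<Lambda> m k r \<le> 0"
      by (rule Lam_sign_mono[of k r "bohr_radius m k"]) (use k r z R in \<open>auto simp: r_def\<close>)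
    moreover have "r ^ (2 * m) = t\<^sup>2" by (simp add: t_def power_mult mult.commute)
    ultimately show ?thesis by (simp add: Lam_def t_def [symmetric] algebra_simps)
  qed
  \<comment> \<open>The left side of \<open>L\<close> is nonnegative, so \<open>L\<close> itself
    yields the monotonicity condition of \<open>bohr_head_le\<close>.\<close>
  have "0 \<le> 2 * (r * (r + k)) * (1 + t)\<^sup>2" using r k by simp
  with L have "0 \<le> (1 - r) * (1 - 2 * t - t\<^sup>2)" by linarith
  then have t': "2 * t \<le> 1 - t\<^sup>2" using r by (simp add: zero_le_mult_iff)
  have head: "norm (h (z ^ m)) + norm (z ^ m) * norm (deriv h (z ^ m)) \<le>
      (t + \<alpha>) / (1 + \<alpha> * t) + t * ((1 - \<alpha>\<^sup>2) / (1 + \<alpha> * t)\<^sup>2)"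
    using bohr_head_le[OF \<alpha>(2,3) t(1) t' norm_ge_zero, of "h (z ^ m)" "norm (deriv h (z ^ m))"]
      Schwarz_Pick_norm_le[OF hol h1 w] Schwarz_Pick_deriv_le[OF hol h1 w]
    by (simp add: t(2) \<alpha>(1))
  have coeff: "norm (a n) \<le> 1 - \<alpha>\<^sup>2" if "n \<ge> 1" for n
    unfolding \<alpha>_def
    by (rule bounded_powser_coeff_le[OF h _ that]) (use h1 \<alpha> in \<open>auto simp: \<alpha>_def less_imp_le\<close>)
  have "(\<Sum>n. norm (b' (n + 1)) * r ^ (n + 1)) \<le> k * (1 - \<alpha>\<^sup>2) * (r / (1 - r))"
    by (rule powser_deriv_dominated_abs_sum_le[OF h g _ coeff k r]) (use dom in auto)
  then have bsum: "(\<Sum>n. norm (b (n + 1)) * r ^ (n + 1)) \<le> k * (1 - \<alpha>\<^sup>2) * (r / (1 - r))"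
    by (simp add: b'_def)
  have geo: "(\<lambda>n. (1 - \<alpha>\<^sup>2) * r ^ (n + 2)) sums ((1 - \<alpha>\<^sup>2) * (r\<^sup>2 / (1 - r)))"
    by (rule sums_mult[OF geometric_tail_sums[OF r]])
  have "summable (\<lambda>n. norm (a (n + 2)) * r ^ (n + 2))"
    using summable_ignore_initial_segment[OF powser_disc_abs_summable[OF sums_summable[OF h] r], of 2] .
  then have "(\<Sum>n. norm (a (n + 2)) * r ^ (n + 2)) \<le> (\<Sum>n. (1 - \<alpha>\<^sup>2) * r ^ (n + 2))"
    by (intro suminf_le sums_summable[OF geo]) (use r in \<open>auto intro!: mult_right_mono coeff\<close>)
  then have "(\<Sum>n. norm (a (n + 2)) * r ^ (n + 2)) \<le> (1 - \<alpha>\<^sup>2) * (r\<^sup>2 / (1 - r))"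
    using sums_unique[OF geo] by simp
  with head bsum bohr_real_inequality[OF \<alpha>(2,3) t(1) r k L] show ?thesis
    unfolding bohr_sum_def r_def [symmetric] by linarith
qed

section \<open>Sharpness of the radius\<close>

text \<open>At \<alpha> = 1 the desired strict inequality is \<open>L\<close> after clearing
  denominators; by continuity it persists for \<alpha> slightly below 1.\<close>

lemma bohr_extremal_parameter:
  fixes r t k :: real
  assumes r: "0 < r" "r < 1" and t: "0 \<le> t"
    and L: "(1 - r) * (1 - 2 * t - t\<^sup>2) < 2 * (r * (r + k)) * (1 + t)\<^sup>2"
  obtains \<alpha> where "0 < \<alpha>" "\<alpha> < 1"
    "(1 - 2 * t - \<alpha> * t\<^sup>2) / (1 + \<alpha> * t)\<^sup>2 < (1 + \<alpha>) * ((r\<^sup>2 * \<alpha> + k * r) / (1 - \<alpha> * r))"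
proof -
  define \<phi> where "\<phi> \<alpha> = (1 - 2 * t - \<alpha> * t\<^sup>2) / (1 + \<alpha> * t)\<^sup>2 - (1 + \<alpha>) * ((r\<^sup>2 * \<alpha> + k * r) / (1 - \<alpha> * r))" for \<alpha>
  have nz: "1 + 1 * t \<noteq> 0" "1 - 1 * r \<noteq> 0" using r t by (auto simp: add_nonneg_eq_0_iff)
  have "(\<phi> \<longlongrightarrow> \<phi> 1) (at_left 1)"
    unfolding \<phi>_def by (intro tendsto_intros) (use nz in auto)
  moreover have "\<phi> 1 < 0"
    using L nz r t by (simp add: \<phi>_def divide_simps) (simp add: power2_eq_square algebra_simps)
  ultimately have "eventually (\<lambda>\<alpha>. \<phi> \<alpha> < 0) (at_left 1)" by (rule order_tendstoD(2))
  then have "eventually (\<lambda>\<alpha>. \<phi> \<alpha> < 0 \<and> \<alpha> \<in> {0<..<1}) (at_left (1::real))"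
    by (intro eventually_conj eventually_at_left_real) auto
  then obtain \<alpha> where "\<phi> \<alpha> < 0" "\<alpha> \<in> {0<..<1}"
    using eventually_happens trivial_limit_at_left_real by blast
  then show thesis by (intro that[of \<alpha>]) (auto simp: \<phi>_def)
qed

lemma bohr_radius_sharp:
  assumes m: "m \<ge> 1" and k: "0 \<le> k" and R': "bohr_radius m k < R'" "R' < 1"
  shows "\<exists>f h g a b. harmonic_mapping f h g a b \<and> h \<in> \<B> \<and>
    (\<forall>z\<in>\<D>. norm (deriv g z) \<le> k * norm (deriv h z)) \<and>
    (\<exists>z\<in>\<D>. norm z \<le> R' \<and> bohr_sum m h a b z > 1)"
proof -
  \<comment> \<open>The violation is exhibited on the circle of radius \<open>R'\<close>
    itself.\<close>
  define r t where "r = R'" and "t = r ^ m"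
  have r: "0 < r" "r < 1" using R' bohr_radius_greatest_root(1)[OF m k] by (auto simp: r_def)
  have t: "0 \<le> t" using r by (simp add: t_def)
  have t1: "t < 1"
    using power_strict_mono[of r 1 m] r m by (simp add: t_def)
  have "0 < \<Lambda> m k r" using Lam_pos_beyond_bohr_radius[OF m k] R' by (simp add: r_def)
  moreover have "r ^ (2 * m) = t\<^sup>2" by (simp add: t_def power_mult mult.commute)
  ultimately have "(1 - r) * (1 - 2 * t - t\<^sup>2) < 2 * (r * (r + k)) * (1 + t)\<^sup>2"
    by (simp add: Lam_def t_def [symmetric] algebra_simps)
  then obtain \<alpha> where \<alpha>: "0 < \<alpha>" "\<alpha> < 1"
      and neg: "(1 - 2 * t - \<alpha> * t\<^sup>2) / (1 + \<alpha> * t)\<^sup>2 < (1 + \<alpha>) * ((r\<^sup>2 * \<alpha> + k * r) / (1 - \<alpha> * r))"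
    using bohr_extremal_parameter[OF r t] by blast
  have \<alpha>2: "0 < 1 - \<alpha>\<^sup>2" using \<alpha> by (simp add: abs_square_less_1)
  \<comment> \<open>This is (z + \<alpha>) / (1 + \<alpha> z), for which both Schwarz--Pick bounds
    are equalities at positive points. Subtracting \<alpha> in \<open>g\<close> makes
    \<open>g 0 = 0\<close>, and g' = k h' exhausts the bound on the derivative.\<close>
  define h where "h = Moebius_function 0 (- of_real \<alpha>)"
  define g where "g z = of_real k * (h z - of_real \<alpha>)" for z
  define a :: "nat \<Rightarrow> complex"
    where "a n = (if n = 0 then of_real \<alpha> else of_real ((1 - \<alpha>\<^sup>2) * (- \<alpha>) ^ (n - 1)))" for n
  define b where "b n = of_real k * a n" for n
  have h_eq: "h z = (z + of_real \<alpha>) / (1 + of_real \<alpha> * z)" for z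
    by (simp add: h_def Moebius_function_simple)
  have nz: "1 + of_real \<alpha> * z \<noteq> 0" if "norm z < 1" for z :: complex
  proof
    assume "1 + of_real \<alpha> * z = 0"
    then have "norm (of_real \<alpha> * z) = 1"
      by (metis add_eq_0_iff norm_minus_cancel norm_one)
    then show False using \<alpha> that mult_strict_mono[of \<alpha> 1 "norm z" 1] by (simp add: norm_mult)
  qed
  have holh: "h holomorphic_on \<D>"
    unfolding h_def by (rule Moebius_function_holomorphic) (use \<alpha> in auto)
  have hB: "h \<in> \<B>"
    using holh Moebius_function_norm_lt_1[of "- of_real \<alpha>"] \<alpha>
    by (auto simp: class_B_def analytic_on_open h_def)
  have holg: "g holomorphic_on \<D>" unfolding g_def by (intro holomorphic_intros holh)
  have dh: "(h has_field_derivative of_real (1 - \<alpha>\<^sup>2) / (1 + of_real \<alpha> * z)\<^sup>2) (at z)"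
    if "norm z < 1" for z
    unfolding h_eq using nz[OF that]
    by (auto intro!: derivative_eq_intros simp: divide_simps power2_eq_square algebra_simps)
  have dg: "deriv g z = of_real k * deriv h z" if "norm z < 1" for z
    unfolding g_def using dh[OF that] DERIV_imp_deriv[OF dh[OF that]]
    by (auto intro!: DERIV_imp_deriv derivative_eq_intros)
  have tail: "(\<lambda>n. a (n + 1) * z ^ (n + 1)) sums (h z - of_real \<alpha>)" if z: "norm z < 1" for z
  proof -
    \<comment> \<open>Here h - \<alpha> equals (1 - \<alpha>^2) z / (1 + \<alpha> z), a geometric
      series of ratio - \<alpha> z; this is the source of the coefficients \<open>a\<close>.\<close>
    define \<beta> :: complex where "\<beta> = - of_real \<alpha>"
    have "norm (\<beta> * z) < 1"
      using \<alpha> z mult_strict_mono[of \<alpha> 1 "norm z" 1] by (simp add: norm_mult \<beta>_def)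
    from sums_mult[OF geometric_sums[OF this], of "of_real (1 - \<alpha>\<^sup>2) * z"]
    have "(\<lambda>n. of_real (1 - \<alpha>\<^sup>2) * \<beta> ^ n * z ^ (n + 1)) sums
        (of_real (1 - \<alpha>\<^sup>2) * z * (1 / (1 - \<beta> * z)))"
      by (simp add: power_mult_distrib mult_ac)
    moreover have "of_real (1 - \<alpha>\<^sup>2) * z * (1 / (1 - \<beta> * z)) = h z - of_real \<alpha>"
      unfolding h_eq \<beta>_def using nz[OF z]
      by (simp add: divide_simps) (simp add: power2_eq_square algebra_simps)
    moreover have "a (n + 1) = of_real (1 - \<alpha>\<^sup>2) * \<beta> ^ n" for n
      by (simp add: a_def \<beta>_def)
    ultimately show ?thesis by simp
  qed
  have hm: "harmonic_mapping (\<lambda>z. h z + cnj (g z)) h g a b"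
  proof -
    have "(\<lambda>n. a n * z ^ n) sums h z" if "norm z < 1" for z
      using sums_Suc[of "\<lambda>n. a n * z ^ n"] tail[OF that] by (fastforce simp: a_def)
    moreover have "(\<lambda>n. b (n + 1) * z ^ (n + 1)) sums g z" if "norm z < 1" for z
      using sums_mult[OF tail[OF that], of "of_real k"] by (simp add: b_def g_def mult_ac)
    ultimately show ?thesis
      using holh holg by (auto simp: harmonic_mapping_def analytic_on_open)
  qed
  have na: "norm (a (n + 1)) = (1 - \<alpha>\<^sup>2) * \<alpha> ^ n" for n
    using \<alpha> \<alpha>2 unfolding a_def by (simp add: norm_mult norm_power abs_mult power_abs del: of_real_diff of_real_power of_real_mult)
  have \<alpha>r: "0 < \<alpha> * r" "\<alpha> * r < 1" using \<alpha> r mult_strict_mono[of \<alpha> 1 r 1] by auto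
  have sa: "(\<lambda>n. norm (a (n + 2)) * r ^ (n + 2)) sums ((1 - \<alpha>\<^sup>2) * (r\<^sup>2 * \<alpha> / (1 - \<alpha> * r)))"
  proof -
    have "norm (a (n + 2)) * r ^ (n + 2) = (1 - \<alpha>\<^sup>2) * \<alpha> * r\<^sup>2 * (\<alpha> * r) ^ n" for n
      using na[of "n + 1"] by (simp add: power_mult_distrib power2_eq_square mult_ac)
    then show ?thesis
      using sums_mult[OF geometric_sums[of "\<alpha> * r"], of "(1 - \<alpha>\<^sup>2) * \<alpha> * r\<^sup>2"] \<alpha>r
      by (simp add: mult_ac)
  qed
  have sb: "(\<lambda>n. norm (b (n + 1)) * r ^ (n + 1)) sums ((1 - \<alpha>\<^sup>2) * (k * r / (1 - \<alpha> * r)))"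
  proof -
    have "norm (b (n + 1)) * r ^ (n + 1) = (1 - \<alpha>\<^sup>2) * k * r * (\<alpha> * r) ^ n" for n
      using na[of n] k by (simp add: b_def norm_mult power_mult_distrib mult_ac)
    then have "(\<lambda>n. norm (b (n + 1)) * r ^ (n + 1)) = (\<lambda>n. (1 - \<alpha>\<^sup>2) * k * r * (\<alpha> * r) ^ n)"
      by (rule ext)
    then show ?thesis
      using sums_mult[OF geometric_sums[of "\<alpha> * r"], of "(1 - \<alpha>\<^sup>2) * k * r"] \<alpha>r
      by (simp only:) (simp add: mult_ac)
  qed
  have \<alpha>t: "0 < 1 + \<alpha> * t" using \<alpha> t by (intro add_pos_nonneg) auto
  \<comment> \<open>At the positive point \<open>r\<close> the values of \<open>h\<close> and h' at
    \<open>z ^ m\<close> are positive reals, so the norms lose nothing.\<close>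
  define z :: complex where "z = of_real r"
  have z: "norm z = r" "z ^ m = of_real t" using r by (auto simp: z_def t_def)
  have hw: "norm (h (z ^ m)) = (t + \<alpha>) / (1 + \<alpha> * t)"
  proof -
    have "h (z ^ m) = of_real ((t + \<alpha>) / (1 + \<alpha> * t))" by (simp add: h_eq z)
    then show ?thesis using \<alpha> t \<alpha>t by (simp only: norm_of_real) simp
  qed
  have dw: "norm (deriv h (z ^ m)) = (1 - \<alpha>\<^sup>2) / (1 + \<alpha> * t)\<^sup>2"
  proof -
    have "deriv h (z ^ m) = of_real ((1 - \<alpha>\<^sup>2) / (1 + \<alpha> * t)\<^sup>2)"
      using DERIV_imp_deriv[OF dh[of "z ^ m"]] t t1 by (simp add: z)
    then show ?thesis using \<alpha>2 \<alpha>t by (simp only: norm_of_real) simp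
  qed
  have "bohr_sum m h a b z = (t + \<alpha>) / (1 + \<alpha> * t) + t * ((1 - \<alpha>\<^sup>2) / (1 + \<alpha> * t)\<^sup>2)
      + (1 - \<alpha>\<^sup>2) * (r\<^sup>2 * \<alpha> / (1 - \<alpha> * r)) + (1 - \<alpha>\<^sup>2) * (k * r / (1 - \<alpha> * r))"
    unfolding bohr_sum_def hw dw z(1) sums_unique[OF sa, symmetric] sums_unique[OF sb, symmetric]
    using t by (simp add: z(2))
  \<comment> \<open>The two tails are merged and 1 - \<alpha>^2 is factored so that
    \<open>1 - \<alpha>\<close> stands in front, as in \<open>one_minus_bohr_head\<close>.\<close>
  also have "\<dots> = (t + \<alpha>) / (1 + \<alpha> * t) + t * ((1 - \<alpha>\<^sup>2) / (1 + \<alpha> * t)\<^sup>2)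
      + (1 - \<alpha>) * ((1 + \<alpha>) * ((r\<^sup>2 * \<alpha> + k * r) / (1 - \<alpha> * r)))"
  proof -
    have "(1 - \<alpha>) * ((1 + \<alpha>) * x) = (1 - \<alpha>\<^sup>2) * x" for x
      by (simp add: power2_eq_square algebra_simps)
    then show ?thesis by (simp only: add_divide_distrib distrib_left add.assoc)
  qed
  finally have "bohr_sum m h a b z = \<dots>" .
  moreover have "(1 - \<alpha>) * ((1 - 2 * t - \<alpha> * t\<^sup>2) / (1 + \<alpha> * t)\<^sup>2) <
      (1 - \<alpha>) * ((1 + \<alpha>) * ((r\<^sup>2 * \<alpha> + k * r) / (1 - \<alpha> * r)))"
    using \<alpha> neg by (intro mult_strict_left_mono) auto
  ultimately have "bohr_sum m h a b z > 1"
    using one_minus_bohr_head[of \<alpha> t] \<alpha> t by linarith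
  moreover have "z \<in> \<D>" "norm z \<le> R'" using r z(1) by (auto simp: r_def)
  moreover have "\<forall>z\<in>\<D>. norm (deriv g z) \<le> k * norm (deriv h z)"
    using k by (auto simp: dg norm_mult)
  ultimately show ?thesis using hm hB by blast
qed

theorem theorem6:
  fixes m :: nat and k :: real
  assumes "m \<ge> 1" and "0 \<le> k" and "k \<le> 1"
  shows "(\<forall>f h g a b.
            harmonic_mapping f h g a b \<and> h \<in> \<B> \<and>
            (\<forall>z\<in>\<D>. norm (deriv g z) \<le> k * norm (deriv h z)) \<longrightarrow>
            (\<forall>z\<in>\<D>. norm z \<le> bohr_radius m k \<longrightarrow> bohr_sum m h a b z \<le> 1)) \<and>
         (\<forall>R'. bohr_radius m k < R' \<and> R' < 1 \<longrightarrow>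
            (\<exists>f h g a b.
               harmonic_mapping f h g a b \<and> h \<in> \<B> \<and>
               (\<forall>z\<in>\<D>. norm (deriv g z) \<le> k * norm (deriv h z)) \<and>
               (\<exists>z\<in>\<D>. norm z \<le> R' \<and> bohr_sum m h a b z > 1)))"
  using bohr_sum_le_one[OF assms(1,2)] bohr_radius_sharp[OF assms(1,2)] by blast

end
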